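(* Let $X,Y\subseteq\mathbb{R}$, $g:Y\to\mathbb{R}$ and $f:X\times Y\to\mathbb{R}$. Suppose $g(y)$ is nonnegative and increasing in $y$, and $f(x,y)$ is nonnegative, submodular in $(x,y)$, and decreasing in $x$. Then $g(y)f(x,y)$ is submodular in $(x,y)$.
   Context: "Increasing" and "decreasing" are meant in the weak sense. A bivariate function $h(x,y)$ is submodular in $(x,y)$ if for all $x^+\ge x^-$ and $y^+\ge y^-$, $$h(x^+,y^-)-h(x^-,y^-)\ \ge\ h(x^+,y^+)-h(x^-,y^+).$$ *)

theory Defs
  imports Complex_Main
begin

definition submodular_on ::
    "real set \<Rightarrow> real set \<Rightarrow> (real \<Rightarrow> real \<Rightarrow> real) \<Rightarrow> bool" where
  "submodular_on X Y h \<longleftrightarrow>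
     (\<forall>x1\<in>X. \<forall>x2\<in>X. \<forall>y1\<in>Y. \<forall>y2\<in>Y.
        x1 \<le> x2 \<longrightarrow> y1 \<le> y2 \<longrightarrow> h x2 y1 - h x1 y1 \<ge> h x2 y2 - h x1 y2)"

end

theory Submission
  imports Defs
begin

text \<open>For fixed \<open>x1 \<le> x2\<close> put D(y) = \<open>f x2 y - f x1 y\<close>; the
  increment of the product in x is \<open>g y\<close> * D(y). Monotonicity of \<open>f\<close> in x
  gives D \<le> 0, and submodularity says that D decreases in y. So \<open>g\<close> and -D are both
  nonnegative and increasing, hence so is their product, and \<open>g y\<close> * D(y) decreases in
  y, as submodularity of the product demands.\<close>

theorem lemma3:
  fixes X Y :: "real set"
    and g :: "real \<Rightarrow> real"
    and f :: "real \<Rightarrow> real \<Rightarrow> real"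
  assumes g_nonneg: "\<And>y. y \<in> Y \<Longrightarrow> 0 \<le> g y"
    and g_inc: "mono_on Y g"
    and f_nonneg: "\<And>x y. x \<in> X \<Longrightarrow> y \<in> Y \<Longrightarrow> 0 \<le> f x y"
    and f_submod: "submodular_on X Y f"
    and f_dec: "\<And>y. y \<in> Y \<Longrightarrow> antimono_on X (\<lambda>x. f x y)"
  shows "submodular_on X Y (\<lambda>x y. g y * f x y)"
proof -
  have "g y2 * f x2 y2 - g y2 * f x1 y2 \<le> g y1 * f x2 y1 - g y1 * f x1 y1"
    if "x1 \<in> X" "x2 \<in> X" "y1 \<in> Y" "y2 \<in> Y" "x1 \<le> x2" "y1 \<le> y2" for x1 x2 y1 y2
  proof -
    have g_le: "g y1 \<le> g y2"
      using g_inc that by (auto dest: mono_onD)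
    have diff_nonpos: "f x2 y2 - f x1 y2 \<le> 0"
      using monotone_onD[OF f_dec[OF \<open>y2 \<in> Y\<close>], of x1 x2] that by simp
    have diff_le: "f x2 y2 - f x1 y2 \<le> f x2 y1 - f x1 y1"
      using f_submod that unfolding submodular_on_def by blast
    \<comment> \<open>The mixed product of \<open>g y1\<close> with the increment at
      \<open>y2\<close> lets the two factors change one at a time. Lowering the weight from
      \<open>g y2\<close> to \<open>g y1\<close> raises the product because the increment is
      nonpositive.\<close>
    have "g y2 * (f x2 y2 - f x1 y2) \<le> g y1 * (f x2 y2 - f x1 y2)"
      using g_le diff_nonpos by (rule mult_right_mono_neg)
    \<comment> \<open>With the weight now fixed at \<open>g y1\<close>, its nonnegativity preserves
      the submodularity inequality.\<close>
    also have "\<dots> \<le> g y1 * (f x2 y1 - f x1 y1)"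
      using diff_le g_nonneg[OF \<open>y1 \<in> Y\<close>] by (rule mult_left_mono)
    finally show ?thesis
      by (simp add: right_diff_distrib)
  qed
  then show ?thesis
    unfolding submodular_on_def by blast
qed

end
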